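(* Let $\mathbb{F}$ be a field with $\operatorname{char}(\mathbb{F}) \neq 2$, let $n \geq 3$, and let $1 \leq k \leq n$ with $(k, n) \neq (2, 4)$. Let $\Phi$ be an automorphism of the maximal subspace graph $\Theta_{n,k}$. Then either $\Phi$ maps the vertex set of $\Theta_{n,k}^{row}$ onto itself and the vertex set of $\Theta_{n,k}^{col}$ onto itself, or $\Phi$ maps the vertex set of $\Theta_{n,k}^{row}$ onto that of $\Theta_{n,k}^{col}$ and the vertex set of $\Theta_{n,k}^{col}$ onto that of $\Theta_{n,k}^{row}$.
   Context: $\operatorname{prk}(A)$ is the size of the largest square submatrix of $A\in\operatorname{Mat}_n(\mathbb{F})$ with nonzero permanent; $\Lambda^{\leq k} = \{A : \operatorname{prk}(A) \leq k\}$. A subspace $V \subseteq \operatorname{Mat}_n(\mathbb{F})$ is called maximal if $V \subseteq \Lambda^{\leq k}$ and $\dim V = kn$. The maximal subspace graph $\Theta_{n,k}$ is the complete undirected weighted graph whose vertices are the maximal subspaces, the weight of the edge between $U$ and $V$ being $w(U,V)=\dim(U\cap V)$. For a $k$-element subset $S \subseteq [n]$, $V_S^{row}$ is the set of matrices $(a_{ij})$ with $a_{ij}=0$ whenever $i \notin S$, and $V_S^{col}$ the set of matrices with $a_{ij}=0$ whenever $j\notin S$. $\Theta_{n,k}^{row}$ (resp. $\Theta_{n,k}^{col}$) is the subgraph of $\Theta_{n,k}$ induced on the vertices $V_S^{row}$ (resp. $V_S^{col}$), $S$ ranging over $k$-element subsets of $[n]$. An automorphism of $\Theta_{n,k}$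 is a bijection $\Phi$ of its vertex set with $w(\Phi(u),\Phi(v)) = w(u,v)$ for all vertices $u,v$. *)

theory Defs
  imports "HOL-Analysis.Analysis"
begin

text \<open>
  \<^const>\<open>vector_scalar_mult\<close> on \<open>'a^'n^'n\<close> takes scalars from \<open>'a^'n\<close>, so the structure of \<open>Mat\<^sub>n(F)\<close>
  as a vector space over \<open>F = 'a\<close> uses its own scalar multiplication.
\<close>

definition mat_scale :: "'a::field \<Rightarrow> 'a^'n^'m \<Rightarrow> 'a^'n^'m" where
  "mat_scale c A = (\<chi> i j. c * A $ i $ j)"

interpretation mat: vector_space "mat_scale :: 'a::field \<Rightarrow> 'a^'n^'m \<Rightarrow> 'a^'n^'m"
  by unfold_locales (simp_all add: mat_scale_def vec_eq_iff algebra_simps)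

text \<open>
  Permanent of the square submatrix with rows \<open>I\<close> and columns \<open>J\<close>, where \<open>card I = card J\<close>. It does
  not depend on how the rows and columns are ordered, so the sum is taken directly over the bijections
  from \<open>I\<close> to \<open>J\<close>, extended by \<^const>\<open>undefined\<close> outside \<open>I\<close> so that each is counted once.
\<close>

definition sub_permanent :: "'a::field^'n^'n \<Rightarrow> 'n set \<Rightarrow> 'n set \<Rightarrow> 'a" where
  "sub_permanent A I J = (\<Sum>f | f \<in> extensional I \<and> bij_betw f I J. \<Prod>i\<in>I. A $ i $ f i)"

text \<open>The empty submatrix has permanent \<open>1\<close>, so the permanental rank of the zero matrix is \<open>0\<close>.\<close>

definition prk :: "'a::field^'n^'n \<Rightarrow> nat" where
  "prk A = Max {card I |I J. card I = card J \<and> sub_permanent A I J \<noteq> 0}"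

definition prk_le :: "nat \<Rightarrow> ('a::field^'n^'n) set" where
  "prk_le k = {A. prk A \<le> k}"

definition maximal_subspaces :: "nat \<Rightarrow> ('a::field^'n^'n) set set" where
  "maximal_subspaces k =
    {V. mat.subspace V \<and> V \<subseteq> prk_le k \<and> mat.dim V = k * CARD('n)}"

definition edge_weight :: "('a::field^'n^'n) set \<Rightarrow> ('a^'n^'n) set \<Rightarrow> nat" where
  "edge_weight U V = mat.dim (U \<inter> V)"

definition row_space :: "'n set \<Rightarrow> ('a::field^'n^'n) set" where
  "row_space S = {A. \<forall>i j. i \<notin> S \<longrightarrow> A $ i $ j = 0}"

definition col_space :: "'n set \<Rightarrow> ('a::field^'n^'n) set" where
  "col_space S = {A. \<forall>i j. j \<notin> S \<longrightarrow> A $ i $ j = 0}"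

definition row_vertices :: "nat \<Rightarrow> ('a::field^'n^'n) set set" where
  "row_vertices k = {row_space S |S. card S = k}"

definition col_vertices :: "nat \<Rightarrow> ('a::field^'n^'n) set set" where
  "col_vertices k = {col_space S |S. card S = k}"

definition subspace_graph_automorphism ::
    "nat \<Rightarrow> (('a::field^'n^'n) set \<Rightarrow> ('a^'n^'n) set) \<Rightarrow> bool" where
  "subspace_graph_automorphism k \<Phi> \<longleftrightarrow>
    bij_betw \<Phi> (maximal_subspaces k) (maximal_subspaces k) \<and>
    (\<forall>U\<in>maximal_subspaces k. \<forall>V\<in>maximal_subspaces k.
      edge_weight (\<Phi> U) (\<Phi> V) = edge_weight U V)"

end

theory Submission
  imports Defs
begin

text \<open>
  Order the matrix positions row by row and let \<open>P\<close> be the set of positions of leading entries of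
  elements of a maximal subspace \<open>V\<close>, so that \<open>card P \<ge> k n\<close>. A triangularity argument shows that
  every permutation meets \<open>P\<close> in at most \<open>k\<close> places; averaging over the rows of a Latin square, it
  meets \<open>P\<close> in exactly \<open>k\<close> places. Comparing permutations that differ by a transposition, \<open>P\<close>
  consists of \<open>k\<close> full rows or of \<open>k\<close> full columns. If \<open>P\<close> consists of the rows in \<open>R\<close>, then \<open>V\<close>
  projects onto these rows, and the vanishing of the permanents of size \<open>k + 1\<close> at a few elements
  of \<open>V\<close> forces all other rows to be zero. Hence the vertices of the graph are exactly the row spaces and the column spaces.
  The weights are \<open>n |S \<inter> T|\<close> within each class and \<open>k\<^sup>2\<close> between the classes. Since \<open>k\<^sup>2 = n (k - 1)\<close>
  only for \<open>(k, n) = (2, 4)\<close>, the edges of weight \<open>n (k - 1)\<close> form a graph whose components are the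
  two classes (two Johnson graphs).
\<close>

section \<open>Permanental rank and coordinate subspaces\<close>

text \<open>All summands but one vanish. The survivor is the restriction of \<open>f\<close> to
  \<open>I\<close>, because the sum runs over extensional functions.\<close>

lemma sub_permanent_unique:
  fixes A :: "'a::field^'n^'n"
  assumes inj: "inj_on f I"
    and un: "\<And>\<tau> i. bij_betw \<tau> I (f ` I) \<Longrightarrow> \<forall>i\<in>I. A $ i $ \<tau> i \<noteq> 0 \<Longrightarrow> i \<in> I \<Longrightarrow> \<tau> i = f i"
  shows "sub_permanent A I (f ` I) = (\<Prod>i\<in>I. A $ i $ f i)"
proof -
  let ?F = "{\<tau>. \<tau> \<in> extensional I \<and> bij_betw \<tau> I (f ` I)}"
  have r: "restrict f I \<in> ?F"
    using inj by (auto simp: bij_betw_def inj_on_def)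
  have z: "(\<Prod>i\<in>I. A $ i $ \<tau> i) = 0" if t: "\<tau> \<in> ?F - {restrict f I}" for \<tau>
  proof (rule ccontr)
    assume "(\<Prod>i\<in>I. A $ i $ \<tau> i) \<noteq> 0"
    then have "\<forall>i\<in>I. A $ i $ \<tau> i \<noteq> 0" by auto
    then have "\<tau> i = f i" if "i \<in> I" for i using un t that by blast
    then have "\<tau> = restrict f I" using t by (auto simp: extensional_def fun_eq_iff)
    then show False using t by blast
  qed
  have "sub_permanent A I (f ` I) = (\<Sum>\<tau>\<in>{restrict f I}. \<Prod>i\<in>I. A $ i $ \<tau> i)"
    unfolding sub_permanent_def using r z by (intro sum.mono_neutral_right) auto
  then show ?thesis by simp
qed

text \<open>Linearity of the permanent in row \<open>m\<close>: every product has exactly one factor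
  from that row.\<close>

lemma sub_permanent_row_add:
  fixes A B C :: "'a::field^'n^'n"
  assumes "m \<in> I" "\<And>j. C $ m $ j = A $ m $ j + B $ m $ j"
    and "\<And>i j. i \<in> I \<Longrightarrow> i \<noteq> m \<Longrightarrow> A $ i $ j = C $ i $ j"
    and "\<And>i j. i \<in> I \<Longrightarrow> i \<noteq> m \<Longrightarrow> B $ i $ j = C $ i $ j"
  shows "sub_permanent C I J = sub_permanent A I J + sub_permanent B I J"
proof -
  have "(\<Prod>i\<in>I. C $ i $ f i) = (\<Prod>i\<in>I. A $ i $ f i) + (\<Prod>i\<in>I. B $ i $ f i)" for f
  proof -
    have "(\<Prod>i\<in>I-{m}. A $ i $ f i) = (\<Prod>i\<in>I-{m}. C $ i $ f i)"
      "(\<Prod>i\<in>I-{m}. B $ i $ f i) = (\<Prod>i\<in>I-{m}. C $ i $ f i)"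
      using assms by (auto intro!: prod.cong)
    moreover have "(\<Prod>i\<in>I. D $ i $ f i) = D $ m $ f m * (\<Prod>i\<in>I-{m}. D $ i $ f i)" for D :: "'a^'n^'n"
      using assms(1) by (simp add: prod.remove)
    ultimately show ?thesis by (simp add: assms(2) algebra_simps)
  qed
  then show ?thesis by (simp add: sub_permanent_def sum.distrib)
qed

lemma sub_permanent_cong:
  assumes "\<And>i j. i \<in> I \<Longrightarrow> A $ i $ j = B $ i $ j"
  shows "sub_permanent A I J = sub_permanent B I J"
  using assms by (auto simp: sub_permanent_def intro!: sum.cong prod.cong)

text \<open>Inverting bijections matches the summands; the inverse is restricted to \<open>J\<close>
  to make it extensional again.\<close>

lemma sub_permanent_transpose:
  fixes A :: "'a::field^'n^'n"
  shows "sub_permanent (transpose A) I J = sub_permanent A J I"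
proof -
  define inv where "inv = (\<lambda>I J (f::'n \<Rightarrow> 'n). restrict (inv_into I f) J)"
  have inv: "inv I J f \<in> extensional J" "bij_betw (inv I J f) J I" "inv J I (inv I J f) = f"
    if "f \<in> extensional I" "bij_betw f I J" for f I J
  proof -
    show "inv I J f \<in> extensional J" by (simp add: inv_def)
    show b: "bij_betw (inv I J f) J I"
      using bij_betw_inv_into[OF that(2)] unfolding inv_def
      by (subst bij_betw_restrict_eq)
    have "inv J I (inv I J f) i = f i" for i
    proof (cases "i \<in> I")
      case True
      then have "f i \<in> J" "inv I J f (f i) = i"
        using that(2) by (auto simp: inv_def bij_betw_def)
      then have "inv_into J (inv I J f) i = f i"
        using b by (metis bij_betw_def inv_into_f_f)
      then show ?thesis using True by (simp add: inv_def)
    qed (use that in \<open>auto simp: inv_def extensional_def\<close>)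
    then show "inv J I (inv I J f) = f" by blast
  qed
  show ?thesis unfolding sub_permanent_def
  proof (rule sum.reindex_bij_witness[where i="inv J I" and j="inv I J"])
    fix f assume f: "f \<in> {f. f \<in> extensional I \<and> bij_betw f I J}"
    have "(\<Prod>i\<in>J. A $ i $ inv I J f i) = (\<Prod>i\<in>I. A $ f i $ inv I J f (f i))"
      using f by (subst prod.reindex_bij_betw[symmetric, of f I J]) auto
    also have "\<dots> = (\<Prod>i\<in>I. A $ f i $ i)"
      using f by (intro prod.cong) (auto simp: inv_def bij_betw_def)
    finally show "(\<Prod>i\<in>J. A $ i $ inv I J f i) = (\<Prod>i\<in>I. transpose A $ i $ f i)"
      by (simp add: transpose_def)
  qed (use inv in auto)
qed

lemma prk_le_iff:
  fixes A :: "'a::field^'n^'n"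
  shows "A \<in> prk_le k \<longleftrightarrow> (\<forall>I J. card I = card J \<longrightarrow> sub_permanent A I J \<noteq> 0 \<longrightarrow> card I \<le> k)"
proof -
  let ?X = "{card I |I J. card I = card J \<and> sub_permanent A I J \<noteq> 0}"
  have "finite ?X"
    by (rule finite_subset[of _ "card ` UNIV"]) auto
  \<comment> \<open>The empty submatrix contributes a single empty product, so the set
    \<open>?X\<close> is nonempty and its maximum is meaningful.\<close>
  moreover have "{f. f \<in> extensional {} \<and> bij_betw f ({}::'n set) ({}::'n set)} = {\<lambda>_. undefined}"
    by (auto simp: bij_betw_def)
  then have "sub_permanent A {} {} \<noteq> 0" by (simp add: sub_permanent_def)
  then have "card ({}::'n set) \<in> ?X" by blast
  then have "?X \<noteq> {}" by blast
  ultimately have "prk A \<le> k \<longleftrightarrow> (\<forall>x\<in>?X. x \<le> k)"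
    unfolding prk_def by (rule Max_le_iff)
  then show ?thesis unfolding prk_le_def by blast
qed

lemma prk_le_transpose: "transpose A \<in> prk_le k \<longleftrightarrow> A \<in> prk_le k"
  unfolding prk_le_iff sub_permanent_transpose by metis

lemma sub_permanent_eq_0_if_prk_le:
  "A \<in> prk_le k \<Longrightarrow> card I = card J \<Longrightarrow> k < card I \<Longrightarrow> sub_permanent A I J = 0"
  unfolding prk_le_iff by (meson not_le)

lemma two_neq_0_if_CHAR_neq_2:
  assumes "CHAR('a::field) \<noteq> 2"
  shows "(2::'a) \<noteq> 0"
proof
  assume "(2::'a) = 0"
  then have "of_nat 2 = (0::'a)" by simp
  then have "CHAR('a) dvd 2" by (simp only: of_nat_eq_0_iff_char_dvd)
  then have "CHAR('a) = 1 \<or> CHAR('a) = 2" by (metis prime_nat_iff two_is_prime_nat)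
  then show False using assms CHAR_not_1' by auto
qed

section \<open>Subspaces of matrices with prescribed support\<close>

text \<open>Common form of row and column spaces: intersections and dimensions reduce to
  intersections and cardinalities of sets of positions.\<close>

definition supported_on :: "('m \<times> 'n) set \<Rightarrow> ('a::field^'n^'m) set" where
  "supported_on Q = {A. \<forall>i j. (i, j) \<notin> Q \<longrightarrow> A $ i $ j = 0}"

lemma mat_scale_nth [simp]: "mat_scale c A $ i $ j = c * A $ i $ j"
  by (simp add: mat_scale_def)

lemma subspace_supported_on: "mat.subspace (supported_on Q)"
  by (auto simp: mat.subspace_def supported_on_def)

text \<open>The matrix units at the positions in \<open>Q\<close> form a basis.\<close>

lemma dim_supported_on:
  fixes Q :: "('m::finite \<times> 'n::finite) set"
  shows "mat.dim (supported_on Q :: ('a::field^'n^'m) set) = card Q"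
proof -
  define E :: "'m \<times> 'n \<Rightarrow> 'a^'n^'m" where "E p = (\<chi> i j. if p = (i, j) then 1 else 0)" for p
  have E: "E p $ i $ j = (if p = (i, j) then 1 else 0)" for p i j by (simp add: E_def)
  have inj: "inj_on E Q"
  proof (rule inj_onI)
    fix p q assume "E p = E q"
    then have "E p $ fst p $ snd p = E q $ fst p $ snd p" by simp
    then show "p = q" by (simp add: E split: if_splits)
  qed
  have nth_sum: "(\<Sum>p\<in>Q. mat_scale (u p) (E p)) $ i $ j = (if (i, j) \<in> Q then u (i, j) else 0)" for u i j
  proof -
    have "(\<Sum>p\<in>Q. mat_scale (u p) (E p)) $ i $ j = (\<Sum>p\<in>Q. u p * (if p = (i, j) then 1 else 0))"
      by (simp add: E)
    also have "\<dots> = (\<Sum>p\<in>Q. if p = (i, j) then u p else 0)" by (intro sum.cong) auto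
    also have "\<dots> = (if (i, j) \<in> Q then u (i, j) else 0)" by simp
    finally show ?thesis .
  qed
  show ?thesis
  proof (rule mat.dim_unique[of "E ` Q"])
    show "E ` Q \<subseteq> supported_on Q" by (auto simp: supported_on_def E)
    show "supported_on Q \<subseteq> mat.span (E ` Q)"
    proof
      fix A :: "'a^'n^'m" assume "A \<in> supported_on Q"
      then have "A = (\<Sum>p\<in>Q. mat_scale (A $ fst p $ snd p) (E p))"
        unfolding vec_eq_iff nth_sum by (auto simp: supported_on_def)
      then show "A \<in> mat.span (E ` Q)"
        by (metis (no_types, lifting) imageI mat.span_base mat.span_scale mat.span_sum)
    qed
    show "mat.independent (E ` Q)"
    proof (rule mat.independent_if_scalars_zero)
      fix u A assume s: "(\<Sum>x\<in>E ` Q. mat_scale (u x) x) = 0" and A: "A \<in> E ` Q"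
      then obtain p where p: "p \<in> Q" "A = E p" by blast
      have "(\<Sum>p\<in>Q. mat_scale (u (E p)) (E p)) = 0"
        using s by (simp add: sum.reindex[OF inj])
      then have "(\<Sum>p\<in>Q. mat_scale (u (E p)) (E p)) $ fst p $ snd p = 0" by simp
      then show "u A = 0" using p unfolding nth_sum by simp
    qed simp
    show "card (E ` Q) = card Q" by (rule card_image[OF inj])
  qed
qed

text \<open>The set is recovered from the subspace: a position belongs to it iff some element is
  nonzero there.\<close>

lemma inj_supported_on: "inj (supported_on :: ('m \<times> 'n) set \<Rightarrow> ('a::field^'n^'m) set)"
proof (rule injI)
  fix P Q :: "('m \<times> 'n) set"
  have mem: "(i, j) \<in> Q \<longleftrightarrow> (\<exists>A\<in>supported_on Q :: ('a^'n^'m) set. A $ i $ j \<noteq> 0)" for i j Q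
  proof
    assume "(i, j) \<in> Q"
    then have "(\<chi> a b. if (a, b) \<in> Q then 1 else 0) \<in> (supported_on Q :: ('a^'n^'m) set)"
      "((\<chi> a b. if (a, b) \<in> Q then 1 else 0) :: 'a^'n^'m) $ i $ j \<noteq> 0"
      by (simp_all add: supported_on_def)
    then show "\<exists>A\<in>supported_on Q :: ('a^'n^'m) set. A $ i $ j \<noteq> 0" by blast
  qed (auto simp: supported_on_def)
  assume "(supported_on P :: ('a^'n^'m) set) = supported_on Q"
  then have "(i, j) \<in> P \<longleftrightarrow> (i, j) \<in> Q" for i j using mem by simp
  then show "P = Q" by auto
qed

lemma row_space_eq_supported_on: "row_space S = supported_on (S \<times> UNIV)"
  by (auto simp: row_space_def supported_on_def)

lemma col_space_eq_supported_on: "col_space S = supported_on (UNIV \<times> S)"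
  by (auto simp: col_space_def supported_on_def)

lemma supported_on_Int: "supported_on P \<inter> supported_on Q = supported_on (P \<inter> Q)"
  by (auto simp: supported_on_def)

lemma edge_weight_row_row:
  "edge_weight (row_space S) (row_space T :: ('a::field^'n^'n) set) = CARD('n) * card (S \<inter> T)"
  by (simp add: edge_weight_def row_space_eq_supported_on supported_on_Int dim_supported_on
      Times_Int_Times card_cartesian_product)

lemma edge_weight_row_col:
  "edge_weight (row_space S) (col_space T) = card S * card T"
  by (simp add: edge_weight_def row_space_eq_supported_on col_space_eq_supported_on
      supported_on_Int dim_supported_on Times_Int_Times card_cartesian_product)

text \<open>A nonzero permanent has a nonzero summand, which uses a nonzero entry in every row of
  \<open>I\<close>; such rows lie in \<open>S\<close>.\<close>

lemma row_space_subset_prk_le: "row_space S \<subseteq> (prk_le (card S) :: ('a::field^'n^'n) set)"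
proof
  fix A :: "'a^'n^'n" assume A: "A \<in> row_space S"
  have "card I \<le> card S" if "sub_permanent A I J \<noteq> 0" for I J
  proof -
    from that obtain f where "(\<Prod>i\<in>I. A $ i $ f i) \<noteq> 0"
      unfolding sub_permanent_def by (meson sum.neutral)
    then have "\<forall>i\<in>I. A $ i $ f i \<noteq> 0" by auto
    then have "I \<subseteq> S" using A unfolding row_space_def by blast
    then show ?thesis by (simp add: card_mono)
  qed
  then show "A \<in> prk_le (card S)" unfolding prk_le_iff by blast
qed

lemma transpose_in_row_space: "transpose A \<in> row_space S \<longleftrightarrow> A \<in> col_space S"
  by (auto simp: row_space_def col_space_def transpose_def)

lemma row_space_maximal: "row_space S \<in> maximal_subspaces (card S)"
  unfolding maximal_subspaces_def using row_space_subset_prk_le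
  by (auto simp: row_space_eq_supported_on subspace_supported_on dim_supported_on card_cartesian_product)

lemma col_space_maximal: "col_space S \<in> maximal_subspaces (card S)"
proof -
  have "col_space S \<subseteq> prk_le (card S)"
    using row_space_subset_prk_le[of S] transpose_in_row_space prk_le_transpose by blast
  then show ?thesis unfolding maximal_subspaces_def
    by (auto simp: col_space_eq_supported_on subspace_supported_on dim_supported_on card_cartesian_product)
qed

section \<open>Leading positions of a maximal subspace\<close>

text \<open>Addition modulo n, transported along an enumeration of the index type. The normalisation
  \<open>\<pi> 0 = id\<close> makes any permutation \<open>\<sigma>\<close> itself one of the
  composites \<open>\<pi> s \<circ> \<sigma>\<close>.\<close>

lemma cyclic_latin_square:
  obtains \<pi> :: "nat \<Rightarrow> 'n::finite \<Rightarrow> 'n"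
  where "\<And>s. bij (\<pi> s)" "\<And>x. bij_betw (\<lambda>s. \<pi> s x) {..<CARD('n)} UNIV" "\<pi> 0 = id"
proof -
  let ?n = "CARD('n)"
  obtain g :: "nat \<Rightarrow> 'n" where g: "bij_betw g {..<?n} UNIV"
    using ex_bij_betw_nat_finite[of "UNIV :: 'n set"] by (auto simp: atLeast0LessThan)
  obtain h :: "'n \<Rightarrow> nat" where h: "bij_betw h UNIV {..<?n}" and gh: "\<And>x. g (h x) = x"
    using g by (metis UNIV_I bij_betw_inv_into bij_betw_inv_into_right)
  have hlt: "h x < ?n" for x using h by (auto simp: bij_betw_def)
  have ginj: "g a = g b \<longleftrightarrow> a = b" if "a < ?n" "b < ?n" for a b
    using g that by (auto simp: bij_betw_def inj_on_def)
  define \<pi> where "\<pi> s x = g ((h x + s) mod ?n)" for s x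
  have cancel_le: "a = b" if "(b + s) mod ?n = (a + s) mod ?n" "a \<le> b" "b < ?n" for a b s :: nat
  proof -
    have "?n dvd (b + s) - (a + s)"
      using that(1,2) by (intro mod_eq_dvd_iff_nat[THEN iffD1]) auto
    then have "b - a = 0" using that(3) by (metis add_diff_cancel_right' diff_diff_left diff_le_self
          dvd_imp_le le_less_trans not_le gr0I diff_cancel2)
    then show ?thesis using that(2) by simp
  qed
  have cancel: "a = b" if "(a + s) mod ?n = (b + s) mod ?n" "a < ?n" "b < ?n" for a b s :: nat
    using cancel_le[of a s b] cancel_le[of b s a] that by (metis nat_le_linear)
  have "inj (\<pi> s)" for s
    by (rule injI) (metis \<pi>_def ginj cancel hlt gh mod_less_divisor zero_less_card_finite)
  then have "bij (\<pi> s)" for s by (simp add: bij_def finite_UNIV_inj_surj)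
  moreover have "inj_on (\<lambda>s. \<pi> s x) {..<?n}" for x
    by (rule inj_onI)
      (metis \<pi>_def ginj cancel add.commute lessThan_iff mod_less_divisor zero_less_card_finite)
  then have "bij_betw (\<lambda>s. \<pi> s x) {..<?n} UNIV" for x
    by (simp add: bij_betw_def card_image card_subset_eq)
  moreover have "\<pi> 0 = id" by (auto simp: \<pi>_def gh hlt)
  ultimately show ?thesis using that by blast
qed

lemma card_eq_sum_of_bool: "card {x::'n::finite. Q x} = (\<Sum>x\<in>UNIV. of_bool (Q x))"
  by simp

lemma full_lines_if_permutation_bound:
  fixes P :: "('n::finite \<times> 'n) set"
  assumes card: "k * CARD('n) \<le> card P"
    and le: "\<And>\<sigma>. bij \<sigma> \<Longrightarrow> card {i. (i, \<sigma> i) \<in> P} \<le> k"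
  obtains R where "card R = k" "P = R \<times> UNIV" | C where "card C = k" "P = UNIV \<times> C"
proof -
  let ?n = "CARD('n)"
  obtain \<pi> :: "nat \<Rightarrow> 'n \<Rightarrow> 'n" where \<pi>: "\<And>s. bij (\<pi> s)"
    "\<And>x. bij_betw (\<lambda>s. \<pi> s x) {..<?n} UNIV" "\<pi> 0 = id"
    using cyclic_latin_square by blast
  \<comment> \<open>For fixed \<open>i\<close>, the column \<open>\<pi> s (\<sigma> i)\<close> runs
    through all columns once, so these n graphs partition the positions.\<close>
  have card_P: "card P = (\<Sum>s<?n. card {i. (i, \<pi> s (\<sigma> i)) \<in> P})" for \<sigma>
  proof -
    have "(\<Sum>s<?n. card {i. (i, \<pi> s (\<sigma> i)) \<in> P})
        = (\<Sum>i\<in>UNIV. \<Sum>s<?n. of_bool ((i, \<pi> s (\<sigma> i)) \<in> P))"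
      unfolding card_eq_sum_of_bool by (rule sum.swap)
    also have "\<dots> = (\<Sum>i\<in>UNIV. \<Sum>j\<in>UNIV. of_bool ((i, j) \<in> P))"
      by (intro sum.cong refl sum.reindex_bij_betw[OF \<pi>(2)])
    also have "\<dots> = (\<Sum>p\<in>UNIV. of_bool (p \<in> P))"
      unfolding sum.cartesian_product by (simp add: case_prod_beta)
    also have "\<dots> = card P" by simp
    finally show ?thesis by simp
  qed
  have le': "card {i. (i, \<pi> s (\<sigma> i)) \<in> P} \<le> k" if "bij \<sigma>" for \<sigma> s
    using le[of "\<pi> s \<circ> \<sigma>"] \<pi>(1) that by (simp add: bij_comp)
  have card_P_eq: "card P = k * ?n"
    using card card_P[of id] sum_bounded_above[of "{..<?n}" "\<lambda>s. card {i. (i, \<pi> s (id i)) \<in> P}" k]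
      le'[of id] by (simp add: mult.commute)
  \<comment> \<open>The n counts are at most \<open>k\<close> and add up to \<open>k\<close> times
    n, so none of them can be smaller.\<close>
  have eq: "card {i. (i, \<sigma> i) \<in> P} = k" if "bij \<sigma>" for \<sigma>
  proof (rule ccontr)
    assume "card {i. (i, \<sigma> i) \<in> P} \<noteq> k"
    then have "card {i. (i, \<pi> 0 (\<sigma> i)) \<in> P} < k" using le that \<pi>(3) by (simp add: le_neq_trans)
    then have "(\<Sum>s<?n. card {i. (i, \<pi> s (\<sigma> i)) \<in> P}) < (\<Sum>s<?n. k)"
      using le'[OF that] by (intro sum_strict_mono_ex1) auto
    then show False using card_P[of \<sigma>] card_P_eq by (simp add: mult.commute)
  qed
  \<comment> \<open>In each 2 by 2 block of positions both diagonals meet \<open>P\<close> equally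
    often: two permutations that differ only in rows \<open>i\<close> and \<open>i'\<close> have the
    same count.\<close>
  have swap: "(of_bool ((i, j) \<in> P) + of_bool ((i', j') \<in> P) :: nat)
      = of_bool ((i, j') \<in> P) + of_bool ((i', j) \<in> P)" if ne: "i \<noteq> i'" "j \<noteq> j'" for i i' j j'
  proof -
    \<comment> \<open>The first transposition sends \<open>i\<close> to \<open>j\<close>; the second
      moves the image of \<open>i'\<close> to \<open>j'\<close> and fixes \<open>j\<close>.\<close>
    define \<sigma> where "\<sigma> = Transposition.transpose (Transposition.transpose i j i') j' \<circ> Transposition.transpose i j"
    have b: "bij \<sigma>" by (simp add: \<sigma>_def bij_comp)
    have \<sigma>: "\<sigma> i = j" "\<sigma> i' = j'"
      using ne by (auto simp: \<sigma>_def Transposition.transpose_def)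
    let ?\<sigma>' = "\<sigma> \<circ> Transposition.transpose i i'"
    have b': "bij ?\<sigma>'" using b by (simp add: bij_comp)
    let ?c = "\<lambda>\<sigma> x. of_bool ((x, \<sigma> x) \<in> P) :: nat"
    have split: "(\<Sum>x\<in>UNIV. ?c \<rho> x) = ?c \<rho> i + ?c \<rho> i' + (\<Sum>x\<in>UNIV - {i, i'}. ?c \<rho> x)" for \<rho>
      using sum.subset_diff[of "{i, i'}" UNIV "?c \<rho>"] ne by simp
    have "(\<Sum>x\<in>UNIV - {i, i'}. ?c ?\<sigma>' x) = (\<Sum>x\<in>UNIV - {i, i'}. ?c \<sigma> x)"
      by (intro sum.cong) (auto simp: Transposition.transpose_def)
    moreover have "(\<Sum>x\<in>UNIV. ?c ?\<sigma>' x) = (\<Sum>x\<in>UNIV. ?c \<sigma> x)"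
      using eq[OF b] eq[OF b'] unfolding card_eq_sum_of_bool by simp
    ultimately have "?c ?\<sigma>' i + ?c ?\<sigma>' i' = ?c \<sigma> i + ?c \<sigma> i'"
      unfolding split by simp
    then show ?thesis using \<sigma> by simp
  qed
  \<comment> \<open>One row that contains \<open>j\<close> and omits \<open>j'\<close> forces every
    row to do the same, by the block identity.\<close>
  have columns: "(i', j) \<in> P \<and> (i', j') \<notin> P" if "(i, j) \<in> P" "(i, j') \<notin> P" for i i' j j'
  proof (cases "i = i'")
    case False
    then show ?thesis using swap[of i i' j j'] that by (cases "j = j'") (auto simp: of_bool_def split: if_splits)
  qed (use that in auto)
  show ?thesis
  proof (cases "\<exists>i j j'. (i, j) \<in> P \<and> (i, j') \<notin> P")
    case True
    then obtain i j j' where ij: "(i, j) \<in> P" "(i, j') \<notin> P" by blast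
    \<comment> \<open>Column \<open>j'\<close> now misses \<open>P\<close> entirely, so a position
      of \<open>P\<close> in any row can be compared with it and moved along its column.\<close>
    have "(a, c) \<in> P" if "(b, c) \<in> P" for a b c
      using columns[of b c j' a] columns[OF ij] that by blast
    then have P: "P = UNIV \<times> {c. (i, c) \<in> P}" by auto
    then have "card P = ?n * card {c. (i, c) \<in> P}" by (metis card_cartesian_product)
    then have "card {c. (i, c) \<in> P} = k" using card_P_eq by (simp add: mult.commute)
    then show ?thesis using P that(2) by blast
  next
    case False
    then have P: "P = {i. \<exists>j. (i, j) \<in> P} \<times> UNIV" by auto
    then have "card P = card {i. \<exists>j. (i, j) \<in> P} * ?n" by (metis card_cartesian_product)
    then have "card {i. \<exists>j. (i, j) \<in> P} = k" using card_P_eq by simp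
    then show ?thesis using P that(1) by blast
  qed
qed

section \<open>Leading entries and Gaussian elimination\<close>

definition leading :: "('m \<times> 'n \<Rightarrow> nat) \<Rightarrow> 'm \<times> 'n \<Rightarrow> 'a::field^'n^'m \<Rightarrow> bool" where
  "leading e p A \<longleftrightarrow> A $ fst p $ snd p \<noteq> 0 \<and> (\<forall>i j. e (i, j) < e p \<longrightarrow> A $ i $ j = 0)"

text \<open>For injective \<open>e\<close>, these are the pivots of an echelon basis of
  \<open>V\<close>, with matrices read as vectors in the order given by \<open>e\<close>.\<close>

definition leading_positions :: "('m \<times> 'n \<Rightarrow> nat) \<Rightarrow> ('a::field^'n^'m) set \<Rightarrow> ('m \<times> 'n) set" where
  "leading_positions e V = {p. \<exists>A\<in>V. leading e p A}"

text \<open>Choosing one element of \<open>V\<close> per leading position gives a spanning set: the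
  earliest nonzero entry of any element can be cleared by a multiple of a chosen one.\<close>

lemma dim_le_card_leading_positions:
  fixes V :: "('a::field^'n::finite^'m::finite) set"
  assumes V: "mat.subspace V" and e: "inj e"
  shows "mat.dim V \<le> card (leading_positions e V)"
proof -
  let ?P = "leading_positions e V"
  have "\<forall>p\<in>?P. \<exists>A. A \<in> V \<and> leading e p A" by (auto simp: leading_positions_def)
  then obtain A where A: "\<And>p. p \<in> ?P \<Longrightarrow> A p \<in> V \<and> leading e p (A p)" by metis
  obtain N where N: "\<And>p. e p < N"
    by (metis finite_class.finite_UNIV finite_imageI finite_nat_set_iff_bounded imageI UNIV_I)
  \<comment> \<open>Downward induction on the rank \<open>t\<close> below which \<open>B\<close>
    vanishes; at \<open>N\<close> nothing of \<open>B\<close> is left.\<close>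
  have "B \<in> mat.span (A ` ?P)" if "B \<in> V" "\<And>i j. e (i, j) < t \<Longrightarrow> B $ i $ j = 0" for B t
    using that
  proof (induction "N - t" arbitrary: B t)
    case 0
    then have "B $ i $ j = 0" for i j using N[of "(i, j)"] by simp
    then have "B = 0" by (simp add: vec_eq_iff)
    then show ?case by (simp add: mat.span_zero)
  next
    case (Suc d)
    have IH: "B' \<in> mat.span (A ` ?P)" if "B' \<in> V" "\<And>i j. e (i, j) < Suc t \<Longrightarrow> B' $ i $ j = 0" for B'
      using Suc.hyps(1)[of "Suc t" B'] Suc.hyps(2) that by simp
    show ?case
    proof (cases "\<exists>i j. e (i, j) = t \<and> B $ i $ j \<noteq> 0")
      case True
      then obtain i j where ij: "e (i, j) = t" "B $ i $ j \<noteq> 0" by blast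
      then have p: "(i, j) \<in> ?P"
        using Suc.prems by (auto simp: leading_positions_def leading_def intro!: bexI[of _ B])
      let ?A = "mat_scale (B $ i $ j / A (i, j) $ i $ j) (A (i, j))"
      have "B - ?A \<in> V"
        using A[OF p] Suc.prems V by (simp add: mat.subspace_diff mat.subspace_scale)
      moreover have "(B - ?A) $ i' $ j' = 0" if "e (i', j') < Suc t" for i' j'
      proof (cases "e (i', j') = t")
        case True
        then have "i' = i" "j' = j" using e ij by (auto dest: injD)
        then show ?thesis using A[OF p] by (simp add: leading_def)
      next
        case False
        then have "e (i', j') < t" using that by simp
        then show ?thesis using A[OF p] Suc.prems(2) ij by (simp add: leading_def)
      qed
      ultimately have "B - ?A \<in> mat.span (A ` ?P)" by (rule IH)
      moreover have "?A \<in> mat.span (A ` ?P)" using p by (simp add: mat.span_base mat.span_scale)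
      ultimately show ?thesis by (metis diff_add_cancel mat.span_add)
    next
      case False
      then show ?thesis using IH Suc.prems by (metis less_Suc_eq)
    qed
  qed
  from this[of _ 0] have "V \<subseteq> mat.span (A ` ?P)" by auto
  then have "mat.dim V \<le> card (A ` ?P)" by (rule mat.dim_le_card) simp
  also have "\<dots> \<le> card ?P" by (simp add: card_image_le)
  finally show ?thesis .
qed

text \<open>The entries at leading positions can be prescribed freely. They are set in increasing
  rank, since adding a multiple of an element with leading entry at a position leaves all earlier
  entries unchanged.\<close>

lemma leading_positions_onto:
  fixes V :: "('a::field^'n::finite^'m::finite) set"
  assumes V: "mat.subspace V" and e: "inj e"
  shows "\<exists>A\<in>V. \<forall>(i, j)\<in>leading_positions e V. A $ i $ j = X i j"
proof -
  let ?P = "leading_positions e V"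
  obtain N where N: "\<And>p. e p < N"
    by (metis finite_class.finite_UNIV finite_imageI finite_nat_set_iff_bounded imageI UNIV_I)
  have "\<exists>A\<in>V. \<forall>i j. (i, j) \<in> ?P \<longrightarrow> e (i, j) < t \<longrightarrow> A $ i $ j = X i j" for t
  proof (induction t)
    case 0
    show ?case using mat.subspace_0[OF V] by auto
  next
    case (Suc t)
    then obtain A where A: "A \<in> V" "\<And>i j. (i, j) \<in> ?P \<Longrightarrow> e (i, j) < t \<Longrightarrow> A $ i $ j = X i j"
      by blast
    show ?case
    proof (cases "\<exists>i j. (i, j) \<in> ?P \<and> e (i, j) = t")
      case True
      then obtain i j where ij: "(i, j) \<in> ?P" "e (i, j) = t" by blast
      then obtain B where B: "B \<in> V" "leading e (i, j) B" by (auto simp: leading_positions_def)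
      let ?A = "A + mat_scale ((X i j - A $ i $ j) / B $ i $ j) B"
      have "?A \<in> V" using A B V by (simp add: mat.subspace_add mat.subspace_scale)
      moreover have "?A $ i' $ j' = X i' j'" if "(i', j') \<in> ?P" "e (i', j') < Suc t" for i' j'
      proof (cases "e (i', j') = t")
        case True
        then have "i' = i" "j' = j" using e ij by (auto dest: injD)
        then show ?thesis using B by (simp add: leading_def)
      next
        case False
        then have "e (i', j') < t" using that by simp
        then show ?thesis using B A that ij by (simp add: leading_def)
      qed
      ultimately show ?thesis by blast
    next
      case False
      then show ?thesis using A by (metis less_Suc_eq)
    qed
  qed
  from this[of N] show ?thesis using N by fastforce
qed

section \<open>Triangularity and the bound on leading positions\<close>

text \<open>A nonzero product for \<tau> requires \<open>h (f i) \<le> h (\<tau> i)\<close>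
  throughout. Both sides have the same sum over \<open>I\<close>, so \<tau> agrees with
  \<open>f\<close> and a single product remains.\<close>

lemma sub_permanent_triangular_neq_0:
  fixes C :: "'a::field^'n^'n" and h :: "'n \<Rightarrow> nat"
  assumes h: "inj h" and f: "inj_on f I"
    and nz: "\<And>i. i \<in> I \<Longrightarrow> C $ i $ f i \<noteq> 0"
    and z: "\<And>i j. i \<in> I \<Longrightarrow> h j < h (f i) \<Longrightarrow> C $ i $ j = 0"
  shows "sub_permanent C I (f ` I) \<noteq> 0"
proof -
  have "\<tau> i = f i" if t: "bij_betw \<tau> I (f ` I)" "\<forall>i\<in>I. C $ i $ \<tau> i \<noteq> 0" and i: "i \<in> I" for \<tau> i
  proof (rule ccontr)
    assume "\<tau> i \<noteq> f i"
    have ge: "h (f i) \<le> h (\<tau> i)" if "i \<in> I" for i using z t(2) that by (meson not_le)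
    have "h (f i) < h (\<tau> i)"
      using ge[OF i] \<open>\<tau> i \<noteq> f i\<close> h by (metis injD le_neq_implies_less)
    then have "(\<Sum>i\<in>I. h (f i)) < (\<Sum>i\<in>I. h (\<tau> i))"
      using ge i by (intro sum_strict_mono_ex1) auto
    moreover have "(\<Sum>i\<in>I. h (\<tau> i)) = (\<Sum>j\<in>f ` I. h j)"
      using t(1) by (rule sum.reindex_bij_betw)
    moreover have "\<dots> = (\<Sum>i\<in>I. h (f i))" using f by (simp add: sum.reindex)
    ultimately show False by simp
  qed
  then have "sub_permanent C I (f ` I) = (\<Prod>i\<in>I. C $ i $ f i)"
    by (rule sub_permanent_unique[OF f])
  then show ?thesis using nz by simp
qed

text \<open>
  Row by row from the top, the matrix \<open>B\<close> is corrected by \<open>0\<close> or \<open>1\<close> times the matrix \<open>A m\<close> whose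
  leading entry lies in row \<open>m\<close>; this leaves the rows above unchanged, and by linearity of the permanent
  in row \<open>m\<close> one of the two choices keeps it nonzero.
\<close>

lemma leading_matching_card_le:
  fixes V :: "('a::field^'n^'n) set" and h :: "'n \<Rightarrow> nat"
  assumes V: "mat.subspace V" "V \<subseteq> prk_le k"
    and h: "inj h" and f: "inj_on f I"
    and AV: "\<And>i. i \<in> I \<Longrightarrow> A i \<in> V"
    and nz: "\<And>i. i \<in> I \<Longrightarrow> A i $ i $ f i \<noteq> 0"
    and above: "\<And>i i' j. i \<in> I \<Longrightarrow> h i' < h i \<Longrightarrow> A i $ i' $ j = 0"
    and left: "\<And>i j. i \<in> I \<Longrightarrow> h j < h (f i) \<Longrightarrow> A i $ i $ j = 0"
  shows "card I \<le> k"
proof -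
  \<comment> \<open>Interpolates between the triangular matrix with rows \<open>A i $ i\<close>, at
    \<open>t = 0\<close>, and \<open>B\<close> itself, once \<open>t\<close> exceeds all
    ranks.\<close>
  define M where "M B t = (\<chi> i. if h i < t then B $ i else A i $ i)" for B t
  have M: "M B t $ i $ j = (if h i < t then B $ i $ j else A i $ i $ j)" for B t i j
    by (simp add: M_def)
  let ?p = "\<lambda>C. sub_permanent C I (f ` I)"
  have "\<exists>B\<in>V. ?p (M B t) \<noteq> 0" for t
  proof (induction t)
    case 0
    have "?p (M 0 0) \<noteq> 0"
      using h f by (rule sub_permanent_triangular_neq_0) (auto simp: M nz left)
    then show ?case using mat.subspace_0[OF V(1)] by blast
  next
    case (Suc t)
    then obtain B where B: "B \<in> V" "?p (M B t) \<noteq> 0" by blast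
    show ?case
    proof (cases "\<exists>m\<in>I. h m = t")
      case True
      then obtain m where m: "m \<in> I" "h m = t" by blast
      have ne: "i \<noteq> m \<Longrightarrow> h i < Suc t \<longleftrightarrow> h i < t" for i
        using h m by (metis injD less_Suc_eq)
      \<comment> \<open>The row \<open>m\<close> of the three matrices is that of
        \<open>B + A m\<close>, \<open>B\<close> and \<open>A m\<close>; the other rows in
        \<open>I\<close> agree, since \<open>A m\<close> vanishes above row
        \<open>m\<close>.\<close>
      have "?p (M (B + A m) (Suc t)) = ?p (M B (Suc t)) + ?p (M B t)"
        using m by (intro sub_permanent_row_add[of m]) (auto simp: M ne above)
      then have "?p (M (B + A m) (Suc t)) \<noteq> 0 \<or> ?p (M B (Suc t)) \<noteq> 0" using B by auto
      then show ?thesis using B AV[OF m(1)] mat.subspace_add[OF V(1)] by blast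
    next
      case False
      then have "?p (M B (Suc t)) = ?p (M B t)"
        by (intro sub_permanent_cong) (auto simp: M less_Suc_eq)
      then show ?thesis using B by metis
    qed
  qed
  moreover obtain N where "\<And>i. h i < N"
    by (metis finite_class.finite_UNIV finite_imageI finite_nat_set_iff_bounded imageI UNIV_I)
  then have "M B N = B" for B by (simp add: vec_eq_iff M)
  ultimately obtain B where "B \<in> V" "?p B \<noteq> 0" by metis
  moreover have "card (f ` I) = card I" using f by (rule card_image)
  ultimately show ?thesis using V(2) sub_permanent_eq_0_if_prk_le by (metis not_le subsetD)
qed

text \<open>In row by row order, an element leading at \<open>(i, \<sigma> i)\<close> vanishes above
  row \<open>i\<close> and left of that entry within the row, as the matching bound requires. The
  leading positions thus fill \<open>k\<close> lines, and \<open>V\<close> takes arbitrary values on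
  them.\<close>

lemma maximal_subspace_onto_lines:
  fixes V :: "('a::field^'n^'n) set"
  assumes "V \<in> maximal_subspaces k"
  obtains R where "card R = k" "\<And>X. \<exists>A\<in>V. \<forall>i\<in>R. \<forall>j. A $ i $ j = X i j"
  | C where "card C = k" "\<And>X. \<exists>A\<in>V. \<forall>i. \<forall>j\<in>C. A $ i $ j = X i j"
proof -
  have V: "mat.subspace V" "V \<subseteq> prk_le k" "mat.dim V = k * CARD('n)"
    using assms by (auto simp: maximal_subspaces_def)
  let ?n = "CARD('n)"
  obtain h :: "'n \<Rightarrow> nat" where h: "bij_betw h UNIV {..<?n}"
    using ex_bij_betw_finite_nat[of "UNIV :: 'n set"] by (auto simp: atLeast0LessThan)
  then have hi: "inj h" and hlt: "\<And>x. h x < ?n" by (auto simp: bij_betw_def)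
  \<comment> \<open>Since \<open>h j\<close> is below n, comparing these numbers is the
    lexicographic comparison of row and column.\<close>
  define e where "e = (\<lambda>(i, j). h i * ?n + h j)"
  have row_less: "e (i, j) < e (i', j')" if "h i < h i'" for i j i' j'
  proof -
    have "h i * ?n + h j < Suc (h i) * ?n" using hlt[of j] by simp
    also have "\<dots> \<le> h i' * ?n" using that by (intro mult_le_mono1) simp
    finally show ?thesis by (simp add: e_def)
  qed
  have e: "inj e"
  proof (rule injI, clarify)
    fix i j i' j' assume eq: "e (i, j) = e (i', j')"
    then have "h i = h i'" using row_less by (metis less_irrefl linorder_neqE_nat)
    then have "h j = h j'" using eq by (simp add: e_def)
    then show "i = i' \<and> j = j'" using \<open>h i = h i'\<close> hi by (simp add: inj_eq)
  qed
  let ?P = "leading_positions e V"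
  have "k * ?n \<le> card ?P" using dim_le_card_leading_positions[OF V(1) e] V(3) by simp
  moreover have "card {i. (i, \<sigma> i) \<in> ?P} \<le> k" if "bij \<sigma>" for \<sigma>
  proof -
    have "\<forall>i. \<exists>A. (i, \<sigma> i) \<in> ?P \<longrightarrow> A \<in> V \<and> leading e (i, \<sigma> i) A"
      by (auto simp: leading_positions_def)
    then obtain A where A: "\<And>i. (i, \<sigma> i) \<in> ?P \<Longrightarrow> A i \<in> V \<and> leading e (i, \<sigma> i) (A i)" by metis
    show ?thesis
    proof (rule leading_matching_card_le[OF V(1,2) hi])
      show "inj_on \<sigma> {i. (i, \<sigma> i) \<in> ?P}" using that by (auto simp: bij_def inj_on_def)
      show "A i \<in> V" if "i \<in> {i. (i, \<sigma> i) \<in> ?P}" for i using A that by blast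
      show "A i $ i $ \<sigma> i \<noteq> 0" if "i \<in> {i. (i, \<sigma> i) \<in> ?P}" for i
        using A that by (auto simp: leading_def)
      show "A i $ i' $ j = 0" if "i \<in> {i. (i, \<sigma> i) \<in> ?P}" "h i' < h i" for i i' j
        using A that row_less by (auto simp: leading_def)
      show "A i $ i $ j = 0" if "i \<in> {i. (i, \<sigma> i) \<in> ?P}" "h j < h (\<sigma> i)" for i j
      proof -
        have "e (i, j) < e (i, \<sigma> i)" using that by (simp add: e_def)
        then show ?thesis using A that by (auto simp: leading_def)
      qed
    qed
  qed
  ultimately show ?thesis
  proof (rule full_lines_if_permutation_bound)
    fix R assume "card R = k" "?P = R \<times> UNIV"
    then show ?thesis using that(1)[of R] leading_positions_onto[OF V(1) e] by simp
  next
    fix C assume "card C = k" "?P = UNIV \<times> C"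
    then show ?thesis using that(2)[of C] leading_positions_onto[OF V(1) e] by simp
  qed
qed

section \<open>Classification of the maximal subspaces\<close>

text \<open>At most n - 2 rows of \<open>R\<close> remain besides \<open>r\<close>, and they fit
  injectively into the columns other than \<open>c\<close> and \<open>d\<close>.\<close>

lemma inj_on_avoiding:
  fixes r c d :: "'n::finite"
  assumes "r \<in> R" "card R < CARD('n)" "c \<noteq> d"
  obtains f where "inj_on f R" "f r = c" "d \<notin> f ` R"
proof -
  have "card (R - {r}) \<le> card (UNIV - {c, d})"
    using assms by (simp add: card_Diff_subset)
  then obtain g where g: "g ` (R - {r}) \<subseteq> UNIV - {c, d}" "inj_on g (R - {r})"
    by (metis card_le_inj finite)
  let ?f = "g(r := c)"
  have "inj_on ?f R" using g by (auto simp: inj_on_def)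
  moreover have "d \<notin> ?f ` R" using g assms by auto
  ultimately show ?thesis using that[of ?f] by simp
qed

text \<open>Each row of \<open>R\<close> must use its column \<open>f r\<close>, which leaves only
  column \<open>d\<close> for row \<open>l\<close>.\<close>

lemma sub_permanent_partial_permutation:
  fixes B :: "'a::field^'n^'n"
  assumes f: "inj_on f R" "d \<notin> f ` R" and l: "l \<notin> R"
    and B: "\<And>r c. r \<in> R \<Longrightarrow> c \<noteq> f r \<Longrightarrow> B $ r $ c = 0"
  shows "sub_permanent B (insert l R) (insert d (f ` R)) = B $ l $ d * (\<Prod>r\<in>R. B $ r $ f r)"
proof -
  let ?g = "f(l := d)"
  have img: "?g ` insert l R = insert d (f ` R)" using l by auto
  have inj: "inj_on ?g (insert l R)" using f l by (auto simp: inj_on_def)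
  have "sub_permanent B (insert l R) (?g ` insert l R) = (\<Prod>r\<in>insert l R. B $ r $ ?g r)"
  proof (rule sub_permanent_unique[OF inj])
    fix \<tau> i assume \<tau>: "bij_betw \<tau> (insert l R) (?g ` insert l R)"
      "\<forall>i\<in>insert l R. B $ i $ \<tau> i \<noteq> 0" and i: "i \<in> insert l R"
    have R: "\<tau> r = f r" if "r \<in> R" for r using B \<tau>(2) that by blast
    have "\<tau> l \<notin> f ` R"
    proof
      assume "\<tau> l \<in> f ` R"
      then obtain r where "r \<in> R" "\<tau> l = \<tau> r" using R by auto
      then show False using \<tau>(1) l by (auto simp: bij_betw_def inj_on_def)
    qed
    moreover have "\<tau> l \<in> insert d (f ` R)" using \<tau>(1) img by (auto simp: bij_betw_def)
    ultimately show "\<tau> i = ?g i" using R i l by auto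
  qed
  also have "\<dots> = B $ l $ d * (\<Prod>r\<in>R. B $ r $ f r)"
    using l by (simp, intro disjI2 prod.cong) auto
  finally show ?thesis by (simp only: img)
qed

text \<open>Elements of \<open>V\<close> that look like a matrix unit on the rows in
  \<open>R\<close> are shown to vanish on all other rows. Hence so do the elements that are zero on
  \<open>R\<close>, and then all of \<open>V\<close>.\<close>

lemma onto_rows_imp_eq_row_space:
  fixes V :: "('a::field^'n^'n) set"
  assumes two: "(2::'a) \<noteq> 0" and n: "CARD('n) \<ge> 3"
    and V: "mat.subspace V" "V \<subseteq> prk_le k"
    and R: "card R = k" "1 \<le> k"
    and onto: "\<And>X. \<exists>A\<in>V. \<forall>i\<in>R. \<forall>j. A $ i $ j = X i j"
  shows "V = row_space R"
proof -
  note clos = mat.subspace_add[OF V(1)] mat.subspace_diff[OF V(1)] mat.subspace_scale[OF V(1)]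
  have zero: "B $ l $ d = 0"
    if "B \<in> V" "l \<notin> R" "inj_on f R" "d \<notin> f ` R" "\<And>r. r \<in> R \<Longrightarrow> B $ r $ f r \<noteq> 0"
      "\<And>r c. r \<in> R \<Longrightarrow> c \<noteq> f r \<Longrightarrow> B $ r $ c = 0" for B l d f
  proof -
    have "sub_permanent B (insert l R) (insert d (f ` R)) = 0"
      using V(2) that R by (intro sub_permanent_eq_0_if_prk_le[of _ k]) (auto simp: card_image)
    then have "B $ l $ d * (\<Prod>r\<in>R. B $ r $ f r) = 0"
      using sub_permanent_partial_permutation[of f R d l B] that by simp
    then show ?thesis using that(5) by auto
  qed
  define unit where "unit r c A \<longleftrightarrow> A \<in> V \<and> (\<forall>i\<in>R. \<forall>j. A $ i $ j = (if i = r \<and> j = c then 1 else 0))"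
    for r c and A :: "'a^'n^'n"
  have ex_unit: "\<exists>A. unit r c A" for r c
    using onto[of "\<lambda>i j. if i = r \<and> j = c then 1 else 0"] unfolding unit_def by blast
  have small: "card R < CARD('n)" if "l \<notin> R" for l
    using that by (metis UNIV_I finite psubsetI psubset_card_mono subset_UNIV)
  have off_column: "A $ l $ d = 0" if A: "unit r c A" and r: "r \<in> R" and l: "l \<notin> R" and d: "c \<noteq> d" for A r c l d
  proof -
    obtain f where f: "inj_on f R" "f r = c" "d \<notin> f ` R"
      using inj_on_avoiding[OF r small[OF l] d] by blast
    obtain B where B: "B \<in> V" "\<forall>i\<in>R. \<forall>j. B $ i $ j = (if j = f i then 1 else 0)"
      using onto[of "\<lambda>i j. if j = f i then 1 else 0"] by blast
    \<comment> \<open>Both \<open>B\<close> and \<open>B - mat_scale 2 A\<close> have the support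
      pattern \<open>f\<close> on \<open>R\<close>; the entry at \<open>(r, c)\<close> changes from
      1 to -1. Their entries at \<open>(l, d)\<close> both vanish, and the difference is twice that
      of \<open>A\<close>.\<close>
    have "B $ l $ d = 0" using B f l by (intro zero[of B l f d]) auto
    moreover have "(2::'a) \<noteq> 1" by (metis one_add_one add_cancel_right_right zero_neq_one)
    then have "(B - mat_scale 2 A) $ l $ d = 0"
      using A B f l clos by (intro zero[of _ l f d]) (auto simp: unit_def)
    ultimately show ?thesis using two by simp
  qed
  have on_columns: "A $ l $ c + A' $ l $ d = 0"
    if A: "unit r c A" "unit r d A'" and r: "r \<in> R" and l: "l \<notin> R" and d: "c \<noteq> d" for A A' r c l d
  proof -
    obtain f where f: "inj_on f R" "f r = c" "d \<notin> f ` R"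
      using inj_on_avoiding[OF r small[OF l] d] by blast
    \<comment> \<open>Redirecting \<open>r\<close> from \<open>c\<close> to \<open>d\<close> frees
      column \<open>c\<close> instead of \<open>d\<close>, within the same set of k + 1
      columns.\<close>
    define f' where "f' = f(r := d)"
    have f': "inj_on f' R" "c \<notin> f' ` R" "insert d (f ` R) = insert c (f' ` R)"
      using f r d unfolding f'_def by (auto simp: inj_on_def)
    obtain B where B: "B \<in> V" "\<forall>i\<in>R. \<forall>j. B $ i $ j = (if j = f i \<and> i \<noteq> r then 1 else 0)"
      using onto[of "\<lambda>i j. if j = f i \<and> i \<noteq> r then 1 else 0"] by blast
    have BA: "(B + A) $ l $ d = 0"
      using A B f l clos by (intro zero[of _ l f d]) (auto simp: unit_def)
    have BA': "(B + A') $ l $ c = 0"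
      using A B f' l clos by (intro zero[of _ l f' c]) (auto simp: unit_def f'_def split: if_splits)
    \<comment> \<open>Row \<open>r\<close> of \<open>B + A + A'\<close> has ones in columns
      \<open>c\<close> and \<open>d\<close>. Splitting it into these two unit rows, with row
      \<open>l\<close> kept, expresses the permanent as the sum of the entries at
      \<open>(l, d)\<close> and \<open>(l, c)\<close>.\<close>
    define M where "M D = (\<chi> i. if i = l then (B + A + A') $ i else (B + D) $ i)" for D
    have Ml: "M D $ l $ j = (B + A + A') $ l $ j" for D j by (simp add: M_def)
    have Mi: "M D $ i $ j = B $ i $ j + D $ i $ j" if "i \<in> R" for D i j
      using that l by (auto simp: M_def)
    let ?I = "insert l R" and ?J = "insert d (f ` R)"
    have "sub_permanent (B + A + A') ?I ?J = sub_permanent (M A) ?I ?J + sub_permanent (M A') ?I ?J"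
      using r l A B by (intro sub_permanent_row_add[of r]) (auto simp: Ml Mi unit_def)
    moreover have "sub_permanent (M A) ?I ?J = (M A) $ l $ d * (\<Prod>r\<in>R. (M A) $ r $ f r)"
      using A B f l by (intro sub_permanent_partial_permutation) (auto simp: Mi unit_def)
    moreover have "(\<Prod>r\<in>R. (M A) $ r $ f r) = 1"
      using A B f by (intro prod.neutral) (auto simp: Mi unit_def)
    moreover have "sub_permanent (M A') ?I (insert c (f' ` R)) = (M A') $ l $ c * (\<Prod>r\<in>R. (M A') $ r $ f' r)"
      using A B f' l by (intro sub_permanent_partial_permutation) (auto simp: Mi unit_def f'_def split: if_splits)
    moreover have "(\<Prod>r\<in>R. (M A') $ r $ f' r) = 1"
      using A B f by (intro prod.neutral) (auto simp: Mi unit_def f'_def)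
    moreover have "sub_permanent (B + A + A') ?I ?J = 0"
      using V(2) A B f l R clos
      by (intro sub_permanent_eq_0_if_prk_le[of _ k]) (auto simp: card_image unit_def)
    ultimately have "(B + A + A') $ l $ d + (B + A + A') $ l $ c = 0" by (simp add: Ml f'(3))
    moreover have "(B + A + A') $ l $ d + (B + A + A') $ l $ c
        = (B + A) $ l $ d + (B + A') $ l $ c + (A $ l $ c + A' $ l $ d)"
      by (simp add: algebra_simps)
    ultimately show ?thesis using BA BA' by simp
  qed
  have unit_row: "A $ l $ j = 0" if A: "unit r c A" and r: "r \<in> R" and l: "l \<notin> R" for A r c l j
  proof (cases "j = c")
    case True
    have "\<exists>d. d \<notin> S" if "card S < 3" for S :: "'n set"
      using n that by (metis UNIV_eq_I not_le)
    from this[of "{c}"] obtain d where d: "d \<noteq> c" by auto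
    have "card {c, d} < 3" using d by simp
    then obtain e where e: "e \<noteq> c" "e \<noteq> d" using \<open>\<And>S. card S < 3 \<Longrightarrow> \<exists>d. d \<notin> S\<close> by blast
    obtain A' A'' where "unit r d A'" "unit r e A''" using ex_unit by blast
    \<comment> \<open>Three quantities with all pairwise sums zero satisfy 2x = 0; the third column
      exists because n is at least 3.\<close>
    then have "A $ l $ c + A' $ l $ d = 0" "A $ l $ c + A'' $ l $ e = 0" "A' $ l $ d + A'' $ l $ e = 0"
      using on_columns A r l d e by blast+
    then have "2 * A $ l $ c = 0" by (simp add: add_eq_0_iff algebra_simps)
    then show ?thesis using two True by simp
  next
    case False
    then show ?thesis using off_column[OF A r l, of j] by simp
  qed
  \<comment> \<open>Adding \<open>D\<close> to a unit element gives a unit element for the same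
    position, and both vanish outside \<open>R\<close>.\<close>
  have kernel: "D $ l $ j = 0" if D: "D \<in> V" "\<forall>i\<in>R. \<forall>j. D $ i $ j = 0" and l: "l \<notin> R" for D l j
  proof -
    obtain r where r: "r \<in> R" using R by fastforce
    obtain A where A: "unit r j A" using ex_unit by blast
    then have "unit r j (A + D)" using D clos by (auto simp: unit_def)
    then show ?thesis using unit_row[OF A r l, of j] unit_row[of r j "A + D" l j] r l by simp
  qed
  obtain U where U: "\<And>r c. unit r c (U r c)" using ex_unit by metis
  have "V \<subseteq> row_space R"
  proof
    fix B assume B: "B \<in> V"
    \<comment> \<open>The combination of unit elements that has the same rows in \<open>R\<close> as
      \<open>B\<close>, so \<open>B - D\<close> is zero there.\<close>
    define D where "D = (\<Sum>r\<in>R. \<Sum>c\<in>UNIV. mat_scale (B $ r $ c) (U r c))"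
    have D: "D \<in> V"
      unfolding D_def using U clos(3) by (intro mat.subspace_sum[OF V(1)]) (auto simp: unit_def)
    have D_nth: "D $ i $ j = (\<Sum>r\<in>R. \<Sum>c\<in>UNIV. B $ r $ c * U r c $ i $ j)" for i j
      by (simp add: D_def)
    have "(B - D) $ i $ j = 0" if i: "i \<in> R" for i j
    proof -
      have "D $ i $ j = (\<Sum>r\<in>R. \<Sum>c\<in>UNIV. if c = j then if r = i then B $ r $ c else 0 else 0)"
        unfolding D_nth using U i by (intro sum.cong) (auto simp: unit_def)
      also have "\<dots> = B $ i $ j" using i by simp
      finally show ?thesis by simp
    qed
    then have "(B - D) $ l $ j = 0" if "l \<notin> R" for l j
      using kernel[of "B - D"] B D clos(2) that by blast
    moreover have "D $ l $ j = 0" if "l \<notin> R" for l j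
      using unit_row[OF U] that by (simp add: D_nth)
    ultimately show "B \<in> row_space R" by (simp add: row_space_def)
  qed
  moreover have "row_space R \<subseteq> V"
  proof
    fix X :: "'a^'n^'n" assume X: "X \<in> row_space R"
    obtain A where A: "A \<in> V" "\<forall>i\<in>R. \<forall>j. A $ i $ j = X $ i $ j"
      using onto[of "\<lambda>i j. X $ i $ j"] by blast
    then have "A \<in> row_space R" using \<open>V \<subseteq> row_space R\<close> by blast
    then have "A = X" using A X unfolding vec_eq_iff row_space_def mem_Collect_eq by metis
    then show "X \<in> V" using A by simp
  qed
  ultimately show ?thesis by blast
qed

text \<open>Transposition preserves the bound on the permanental rank and turns this into the row
  case.\<close>

lemma onto_columns_imp_eq_col_space:
  fixes V :: "('a::field^'n^'n) set"
  assumes two: "(2::'a) \<noteq> 0" and n: "CARD('n) \<ge> 3"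
    and V: "mat.subspace V" "V \<subseteq> prk_le k"
    and C: "card C = k" "1 \<le> k"
    and onto: "\<And>X. \<exists>A\<in>V. \<forall>i. \<forall>j\<in>C. A $ i $ j = X i j"
  shows "V = col_space C"
proof -
  let ?W = "{A. transpose A \<in> V}"
  have [simp]: "transpose (0 :: 'a^'n^'n) = 0" "transpose (A + B) = transpose A + transpose B"
    "transpose (mat_scale c A) = mat_scale c (transpose A)" for A B :: "'a^'n^'n" and c
    by (simp_all add: transpose_def vec_eq_iff)
  have "?W = row_space C"
  proof (rule onto_rows_imp_eq_row_space[OF two n _ _ C])
    show "mat.subspace ?W" using V(1) by (simp add: mat.subspace_def)
    show "?W \<subseteq> prk_le k" using V(2) prk_le_transpose by blast
    fix X :: "'n \<Rightarrow> 'n \<Rightarrow> 'a"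
    obtain A where A: "A \<in> V" "\<forall>i. \<forall>j\<in>C. A $ i $ j = X j i" using onto[of "\<lambda>i j. X j i"] by blast
    then show "\<exists>A\<in>?W. \<forall>i\<in>C. \<forall>j. A $ i $ j = X i j"
      by (intro bexI[of _ "transpose A"]) (simp_all, simp add: transpose_def)
  qed
  then have "transpose A \<in> row_space C \<longleftrightarrow> transpose (transpose A) \<in> V" for A by blast
  then show ?thesis by (auto simp: transpose_in_row_space)
qed

theorem maximal_subspaces_eq:
  assumes "CHAR('a::field) \<noteq> 2" "CARD('n::finite) \<ge> 3" "1 \<le> k"
  shows "(maximal_subspaces k :: ('a^'n^'n) set set) = row_vertices k \<union> col_vertices k"
proof
  note two = two_neq_0_if_CHAR_neq_2[OF assms(1)]
  show "(maximal_subspaces k :: ('a^'n^'n) set set) \<subseteq> row_vertices k \<union> col_vertices k"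
  proof
    fix V :: "('a^'n^'n) set" assume m: "V \<in> maximal_subspaces k"
    then have V: "mat.subspace V" "V \<subseteq> prk_le k" by (auto simp: maximal_subspaces_def)
    from m show "V \<in> row_vertices k \<union> col_vertices k"
    proof (cases rule: maximal_subspace_onto_lines)
      case (1 R)
      then show ?thesis
        using onto_rows_imp_eq_row_space[OF two assms(2) V 1(1) assms(3)] by (auto simp: row_vertices_def)
    next
      case (2 C)
      then show ?thesis
        using onto_columns_imp_eq_col_space[OF two assms(2) V 2(1) assms(3)] by (auto simp: col_vertices_def)
    qed
  qed
  show "row_vertices k \<union> col_vertices k \<subseteq> (maximal_subspaces k :: ('a^'n^'n) set set)"
    using row_space_maximal col_space_maximal by (auto simp: row_vertices_def col_vertices_def)
qed

section \<open>Automorphisms\<close>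

text \<open>Connectedness of the Johnson graph: exchanging an element of \<open>S - T\<close> for
  one of \<open>T - S\<close> is a single edge and shrinks \<open>T - S\<close>.\<close>

lemma exchange_connected:
  fixes S T :: "'n::finite set"
  assumes step: "\<And>S T. card S = k \<Longrightarrow> card T = k \<Longrightarrow> card (S \<inter> T) = k - 1 \<Longrightarrow> Q S \<Longrightarrow> Q T"
    and "card S = k" "card T = k" "Q S"
  shows "Q T"
  using assms(2-)
proof (induction "card (T - S)" arbitrary: S)
  case 0
  then have "T = S" by (simp add: card_subset_eq)
  then show ?case using 0 by simp
next
  case (Suc d)
  then obtain t where t: "t \<in> T" "t \<notin> S"
    by (metis Diff_iff card.empty equals0I nat.distinct(1))
  have "\<not> S \<subseteq> T" using t Suc.prems by (metis card_subset_eq finite)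
  then obtain s where s: "s \<in> S" "s \<notin> T" by blast
  define S' where "S' = insert t (S - {s})"
  have "card S' = Suc (card (S - {s}))"
    unfolding S'_def by (rule card_insert_disjoint) (use t in auto)
  also have "\<dots> = card S" by (rule card_Suc_Diff1) (use s in auto)
  finally have c: "card S' = k" using Suc.prems(1) by (rule trans)
  have "S \<inter> S' = S - {s}" using t by (auto simp: S'_def)
  then have "card (S \<inter> S') = k - 1" using s Suc.prems by simp
  then have "Q S'" using step Suc.prems c by blast
  moreover have "T - S = insert t (T - S')" "t \<notin> T - S'" using s t by (auto simp: S'_def)
  then have "d = card (T - S')" using Suc.hyps(2) by simp
  ultimately show ?case using Suc.hyps(1) Suc.prems(2) c by blast
qed

text \<open>With k = m + 1 the equation becomes 1 + m (m + 2) = n m, so m divides 1 and (k, n) = (2,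
  4).\<close>

lemma square_neq_mult_pred:
  fixes n k :: nat
  assumes "1 \<le> k" "k < n" "(k, n) \<noteq> (2, 4)"
  shows "k * k \<noteq> n * (k - 1)"
proof
  assume eq: "k * k = n * (k - 1)"
  obtain m where k: "k = Suc m" using assms(1) by (cases k) auto
  have "1 + m * (m + 2) = n * m" using eq k by simp
  then have "m dvd 1" by (metis dvd_add_times_triv_right_iff dvd_triv_right mult.commute)
  then have "m = 1" by simp
  then show False using eq k assms by simp
qed

text \<open>The space would meet itself in dimension n k as a row space, but in dimension k k by the
  formula for a row and a column space.\<close>

lemma row_col_disjoint:
  assumes "card S = k" "card T = k" "1 \<le> k" "k < CARD('n)"
  shows "row_space S \<noteq> (col_space T :: ('a::field^'n^'n) set)"
proof
  assume eq: "row_space S = (col_space T :: ('a^'n^'n) set)"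
  have "edge_weight (row_space S) (row_space S :: ('a^'n^'n) set) = k * k"
    by (subst (2) eq) (simp add: edge_weight_row_col assms)
  then show False using assms by (simp add: edge_weight_row_row)
qed

theorem theorem4p4:
  fixes \<Phi> :: "('a::field^'n^'n) set \<Rightarrow> ('a^'n^'n) set" and k :: nat
  assumes "CHAR('a) \<noteq> 2"
    and "CARD('n) \<ge> 3"
    and "1 \<le> k" and "k \<le> CARD('n)"
    and "(k, CARD('n)) \<noteq> (2, 4)"
    and "subspace_graph_automorphism k \<Phi>"
  shows "(\<Phi> ` row_vertices k = row_vertices k \<and> \<Phi> ` col_vertices k = col_vertices k) \<or>
    (\<Phi> ` row_vertices k = col_vertices k \<and> \<Phi> ` col_vertices k = row_vertices k)"
proof -
  let ?R = "row_vertices k :: ('a^'n^'n) set set" and ?C = "col_vertices k :: ('a^'n^'n) set set"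
  note max = maximal_subspaces_eq[OF assms(1-3)]
  have bij: "bij_betw \<Phi> (?R \<union> ?C) (?R \<union> ?C)"
    and wt: "\<And>U V. U \<in> ?R \<union> ?C \<Longrightarrow> V \<in> ?R \<union> ?C \<Longrightarrow> edge_weight (\<Phi> U) (\<Phi> V) = edge_weight U V"
    using assms(6) unfolding subspace_graph_automorphism_def max by auto
  show ?thesis
  proof (cases "k = CARD('n)")
    case True
    \<comment> \<open>For k = n the full matrix space is the only vertex and belongs to both
      classes.\<close>
    then have "card S = k \<longleftrightarrow> S = UNIV" for S :: "'n set" by (metis card_subset_eq finite subset_UNIV)
    moreover have "row_space UNIV = (UNIV :: ('a^'n^'n) set)" "col_space UNIV = (UNIV :: ('a^'n^'n) set)"
      by (auto simp: row_space_def col_space_def)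
    ultimately have "?R = {UNIV}" "?C = {UNIV}" by (auto simp: row_vertices_def col_vertices_def)
    then show ?thesis using bij by (simp add: bij_betw_def)
  next
    case False
    then have k: "k < CARD('n)" using assms(4) by simp
    have fin: "finite ?R" "finite ?C"
      unfolding row_vertices_def col_vertices_def by (simp_all add: setcompr_eq_image)
    have disj: "?R \<inter> ?C = {}"
      using row_col_disjoint[OF _ _ assms(3) k] by (fastforce simp: row_vertices_def col_vertices_def)
    have inj_r: "inj (row_space :: 'n set \<Rightarrow> ('a^'n^'n) set)"
      and inj_c: "inj (col_space :: 'n set \<Rightarrow> ('a^'n^'n) set)"
      unfolding inj_def row_space_eq_supported_on col_space_eq_supported_on
      by (auto dest!: injD[OF inj_supported_on])
    have card_eq: "card ?R = card ?C"
      unfolding row_vertices_def col_vertices_def setcompr_eq_image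
      using card_image[OF inj_on_subset[OF inj_r subset_UNIV], of "{S. card S = k}"]
        card_image[OF inj_on_subset[OF inj_c subset_UNIV], of "{S. card S = k}"] by simp
    \<comment> \<open>An edge of weight n (k - 1) never joins the two classes, since all edges
      between them have weight k k.\<close>
    have same_side: "U \<in> ?R \<longleftrightarrow> V \<in> ?R"
      if "U \<in> ?R \<union> ?C" "V \<in> ?R \<union> ?C" "edge_weight U V = CARD('n) * (k - 1)" for U V
    proof -
      have rc: "edge_weight X Y \<noteq> CARD('n) * (k - 1)" if "X \<in> ?R" "Y \<in> ?C" for X Y
        using that square_neq_mult_pred[OF assms(3) k assms(5)]
        by (auto simp: row_vertices_def col_vertices_def edge_weight_row_col)
      have "edge_weight V U = edge_weight U V" by (simp add: edge_weight_def Int_commute)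
      then have "\<not> (U \<in> ?R \<and> V \<in> ?C)" "\<not> (V \<in> ?R \<and> U \<in> ?C)" using rc that(3) by metis+
      then show ?thesis using that(1,2) disj by blast
    qed
    have step: "\<Phi> (row_space S) \<in> ?R \<longleftrightarrow> \<Phi> (row_space T) \<in> ?R"
      if "card S = k" "card T = k" "card (S \<inter> T) = k - 1" for S T
    proof -
      have "row_space S \<in> ?R \<union> ?C" "row_space T \<in> ?R \<union> ?C" using that by (auto simp: row_vertices_def)
      moreover from this have "edge_weight (\<Phi> (row_space S)) (\<Phi> (row_space T)) = CARD('n) * (k - 1)"
        by (simp only: wt edge_weight_row_row that)
      ultimately show ?thesis using same_side bij_betw_apply[OF bij] by blast
    qed
    \<comment> \<open>Connectedness is applied to the property that the image lies in the same class
      as the image of the fixed \<open>row_space S\<close>.\<close>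
    have "\<Phi> (row_space S) \<in> ?R \<longleftrightarrow> \<Phi> (row_space T) \<in> ?R" if "card S = k" "card T = k" for S T
      using exchange_connected[of k "\<lambda>T. \<Phi> (row_space S) \<in> ?R \<longleftrightarrow> \<Phi> (row_space T) \<in> ?R" S T] step that
      by blast
    then have "\<Phi> U \<in> ?R \<longleftrightarrow> \<Phi> V \<in> ?R" if "U \<in> ?R" "V \<in> ?R" for U V
      using that unfolding row_vertices_def by blast
    moreover have "\<Phi> U \<in> ?R \<union> ?C" if "U \<in> ?R" for U
      using bij_betw_apply[OF bij] that by blast
    ultimately have "\<Phi> ` ?R \<subseteq> ?R \<or> \<Phi> ` ?R \<subseteq> ?C" by blast
    \<comment> \<open>The classes have equal size, which upgrades the inclusion of the image in one
      class to equality; the columns then fill the complement.\<close>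
    moreover have "card (\<Phi> ` ?R) = card ?R"
      using bij by (meson bij_betw_def card_image inj_on_subset sup_ge1)
    ultimately have "\<Phi> ` ?R = ?R \<or> \<Phi> ` ?R = ?C" using fin card_eq by (metis card_subset_eq)
    moreover have "\<Phi> ` ?C = (?R \<union> ?C) - \<Phi> ` ?R"
    proof -
      have "\<Phi> ` ((?R \<union> ?C) - ?R) = \<Phi> ` (?R \<union> ?C) - \<Phi> ` ?R"
        using bij by (intro inj_on_image_set_diff[of _ "?R \<union> ?C"]) (auto simp only: bij_betw_def)
      moreover have "(?R \<union> ?C) - ?R = ?C" using disj by blast
      moreover have "\<Phi> ` (?R \<union> ?C) = ?R \<union> ?C" using bij by (simp only: bij_betw_def)
      ultimately show ?thesis by metis
    qed
    moreover have "(?R \<union> ?C) - ?R = ?C" "(?R \<union> ?C) - ?C = ?R" using disj by blast+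
    ultimately show ?thesis by metis
  qed
qed

end
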